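(* Let $m\geq 1$ and let $\mathcal{P}$ be the set of real $m\times m$ matrices $A$ such that the map $F_A:\mathbb{R}^m\to\mathbb{R}^m$, $F_A(x)=x+(Ax)^3$, is proper. For every integer $r$ with $0\leq r\leq m$, the set $\mathcal{P}$ contains an open dense subset of the set of real $m\times m$ matrices of rank exactly $r$.
   Context: Powers of vectors are coordinatewise: $x^3=(x_1^3,\ldots,x_m^3)$. A map is proper if preimages of compact sets are compact. The set of matrices of rank exactly $r$ carries the topology induced from the space of all real $m\times m$ matrices. *)

theory Defs
  imports "HOL-Analysis.Analysis"
begin

definition proper_fun :: "('a::topological_space \<Rightarrow> 'b::topological_space) \<Rightarrow> bool" where
  "proper_fun f \<longleftrightarrow> (\<forall>K. compact K \<longrightarrow> compact (f -` K))"

definition vec_power :: "real ^ 'm \<Rightarrow> nat \<Rightarrow> real ^ 'm" where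
  "vec_power x k = (\<chi> i. (x $ i) ^ k)"

definition cubic_map :: "real ^ 'm ^ 'm \<Rightarrow> real ^ 'm \<Rightarrow> real ^ 'm" where
  "cubic_map A x = x + vec_power (A *v x) 3"

definition proper_matrices :: "(real ^ 'm ^ 'm) set" where
  "proper_matrices = {A. proper_fun (cubic_map A)}"

definition rank_stratum :: "nat \<Rightarrow> (real ^ 'm ^ 'm) set" where
  "rank_stratum r = {A. rank A = r}"

end

theory Submission
  imports Defs
begin

text \<open>The map \<open>x + (A x)\<^sup>3\<close> is proper as soon as the homogeneous map \<open>x \<mapsto> A (A x)\<^sup>3\<close> vanishes only on
  the kernel of \<open>A\<close>. On matrices of constant rank this is an open condition by compactness of a
  sphere. It is dense because replacing \<open>A\<close> by \<open>A P\<close> with \<open>P\<close> invertible keeps the rank and the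
  range, while the matrices \<open>P\<close> for which the condition fails form a null set by a dimension
  count.\<close>

section \<open>Nondegeneracy as a sufficient condition for properness\<close>

definition cubic_nondegenerate :: "real ^ 'm ^ 'm \<Rightarrow> bool" where
  "cubic_nondegenerate A \<longleftrightarrow> (\<forall>x. A *v vec_power (A *v x) 3 = 0 \<longrightarrow> A *v x = 0)"

lemma vec_power_scaleR: "vec_power (c *\<^sub>R x) k = c ^ k *\<^sub>R vec_power x k"
  by (simp add: vec_power_def vec_eq_iff power_mult_distrib)

lemma continuous_on_vec_power [continuous_intros]:
  fixes f :: "'a::topological_space \<Rightarrow> real ^ 'm"
  assumes "continuous_on S f"
  shows "continuous_on S (\<lambda>x. vec_power (f x) k)"
  unfolding vec_power_def by (intro continuous_intros assms)

lemma continuous_on_matrix_vector_mult_joint: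
  fixes f :: "'a::topological_space \<Rightarrow> real ^ 'n ^ 'm"
  assumes "continuous_on S f" "continuous_on S g"
  shows "continuous_on S (\<lambda>x. f x *v g x)"
  unfolding matrix_vector_mult_def by (intro continuous_intros assms)

lemma continuous_on_cubic_map: "continuous_on S (cubic_map A)"
  unfolding cubic_map_def [abs_def]
  by (intro continuous_intros continuous_on_matrix_vector_mult_joint)

text \<open>Compactness of the unit sphere in the range of \<open>A\<close> gives a positive
  minimum, and homogeneity of degree 3 spreads it to the whole range.\<close>

lemma cubic_nondegenerate_lower_bound:
  fixes A :: "real ^ 'm ^ 'm"
  assumes "cubic_nondegenerate A"
  obtains c where "c > 0"
    "\<And>x. c * norm (A *v x) ^ 3 \<le> norm (A *v vec_power (A *v x) 3)"
proof -
  define S where "S = range ((*v) A) \<inter> sphere 0 1"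
  have S: "compact S"
    unfolding S_def by (intro closed_Int_compact closed_subspace)
      (auto intro: linear_subspace_image)
  have "\<exists>c>0. \<forall>u\<in>S. c \<le> norm (A *v vec_power u 3)"
  \<comment> \<open>\<open>S\<close> is empty exactly when \<open>A\<close> = 0, and then any
    positive constant serves.\<close>
  proof (cases "S = {}")
    case False
    have "continuous_on S (\<lambda>u. norm (A *v vec_power u 3))"
      by (intro continuous_intros continuous_on_matrix_vector_mult_joint)
    then obtain u where u: "u \<in> S"
      "\<forall>v\<in>S. norm (A *v vec_power u 3) \<le> norm (A *v vec_power v 3)"
      using continuous_attains_inf [OF S False] by blast
    then have "A *v vec_power u 3 \<noteq> 0"
      using assms by (auto simp: S_def cubic_nondegenerate_def)
    with u show ?thesis
      by (intro exI [of _ "norm (A *v vec_power u 3)"]) auto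
  qed (auto intro: exI [of _ 1])
  then obtain c where c: "c > 0" "\<And>u. u \<in> S \<Longrightarrow> c \<le> norm (A *v vec_power u 3)"
    by blast
  have "c * norm (A *v x) ^ 3 \<le> norm (A *v vec_power (A *v x) 3)" for x
  proof (cases "A *v x = 0")
    case False
    define u where "u = (1 / norm (A *v x)) *\<^sub>R (A *v x)"
    have "u = A *v ((1 / norm (A *v x)) *\<^sub>R x)"
      by (simp add: u_def matrix_vector_mult_scaleR)
    moreover have "norm u = 1"
      using False by (simp add: u_def)
    ultimately have "u \<in> S"
      unfolding S_def by auto
    have "A *v x = norm (A *v x) *\<^sub>R u"
      using False by (simp add: u_def)
    then have "norm (A *v vec_power (A *v x) 3)
        = norm (A *v vec_power (norm (A *v x) *\<^sub>R u) 3)"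
      by simp
    also have "\<dots> = norm (A *v x) ^ 3 * norm (A *v vec_power u 3)"
      by (simp add: vec_power_scaleR matrix_vector_mult_scaleR)
    finally show ?thesis
      using mult_left_mono [OF c(2) [OF \<open>u \<in> S\<close>], of "norm (A *v x) ^ 3"]
      by (simp add: mult.commute [of c])
  qed simp
  with c(1) show thesis
    by (rule that)
qed

text \<open>With \<open>y = A x\<close> and \<open>z = cubic_map A x\<close>, applying \<open>A\<close> gives \<open>A z = y + A y\<^sup>3\<close>, and the cubic term
  dominates on the range of \<open>A\<close>.\<close>

lemma cubic_nondegenerate_imp_proper:
  assumes "cubic_nondegenerate A"
  shows "proper_fun (cubic_map A)"
  unfolding proper_fun_def
proof (intro allI impI)
  fix K :: "(real ^ 'a) set"
  assume K: "compact K"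
  obtain c where c: "c > 0"
    "\<And>x. c * norm (A *v x) ^ 3 \<le> norm (A *v vec_power (A *v x) 3)"
    using cubic_nondegenerate_lower_bound [OF assms] by blast
  have "bounded ((*v) A ` K)"
    by (intro compact_imp_bounded compact_continuous_image K
        continuous_on_matrix_vector_mult_joint continuous_intros)
  then obtain R where R: "R > 0" "\<And>z. z \<in> K \<Longrightarrow> norm (A *v z) \<le> R"
    unfolding bounded_pos by blast
  \<comment> \<open>If n > b, then n > 1 and c n > R + 1, so c n^3 > (R + 1) n^2 \<ge> R + n, which
    the estimate below contradicts.\<close>
  define b where "b = max 1 ((R + 1) / c)"
  have y_le: "norm (A *v x) \<le> b" if "cubic_map A x \<in> K" for x
  proof (rule ccontr)
    define n where "n = norm (A *v x)"
    assume "\<not> norm (A *v x) \<le> b"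
    then have n: "n > 1" "(R + 1) / c < n"
      by (auto simp: b_def n_def)
    then have cn: "R + 1 < c * n"
      using c(1) by (simp add: pos_divide_less_eq mult.commute)
    have "A *v vec_power (A *v x) 3 = A *v cubic_map A x - A *v x"
      by (simp add: cubic_map_def matrix_vector_right_distrib)
    then have "c * n ^ 3 \<le> norm (A *v cubic_map A x - A *v x)"
      using c(2) [of x] by (simp add: n_def)
    also have "\<dots> \<le> R + n"
      unfolding n_def using R(2) [OF that] norm_triangle_ineq4 by (smt (verit))
    also have "\<dots> \<le> (R + 1) * n"
      using R(1) n(1) by (simp add: algebra_simps)
    also have "\<dots> \<le> (R + 1) * n ^ 2"
      using R(1) n(1) by (intro mult_left_mono) (auto simp: power2_eq_square)
    also have "\<dots> < (c * n) * n ^ 2"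
      using cn n(1) by (intro mult_strict_right_mono) auto
    finally show False
      by (simp add: power2_eq_square power3_eq_cube)
  qed
  \<comment> \<open>A point x is recovered as z - y^3 from its image z in \<open>K\<close> and y = A
    x in a fixed ball, so the preimage lies in a compact set.\<close>
  have "compact ((\<lambda>p. fst p - vec_power (snd p) 3) ` (K \<times> cball (0 :: real ^ 'a) b))"
    by (intro compact_continuous_image compact_Times K compact_cball continuous_intros)
  moreover have "cubic_map A -` K
      \<subseteq> (\<lambda>p. fst p - vec_power (snd p) 3) ` (K \<times> cball (0 :: real ^ 'a) b)"
  proof
    fix x
    assume x: "x \<in> cubic_map A -` K"
    then have "(cubic_map A x, A *v x) \<in> K \<times> cball (0 :: real ^ 'a) b"
      using y_le by simp
    moreover have "x = fst (cubic_map A x, A *v x) - vec_power (snd (cubic_map A x, A *v x)) 3"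
      by (simp add: cubic_map_def)
    ultimately show "x \<in> (\<lambda>p. fst p - vec_power (snd p) 3) ` (K \<times> cball (0 :: real ^ 'a) b)"
      by (rule rev_image_eqI)
  qed
  moreover have "closed (cubic_map A -` K)"
    by (intro continuous_closed_vimage compact_imp_closed K)
      (use continuous_on_cubic_map [of UNIV A] in \<open>simp add: continuous_on_eq_continuous_at\<close>)
  ultimately show "compact (cubic_map A -` K)"
    by (meson bounded_subset compact_eq_bounded_closed)
qed

section \<open>Openness of nondegeneracy among matrices of fixed rank\<close>

text \<open>A linear right inverse of \<open>A\<close> on its range serves as \<open>G\<close>. Then
  \<open>G ** A\<close> is a projection with the same kernel as \<open>A\<close>, so its range is a
  complement of that kernel.\<close>

lemma matrix_generalized_inverse:
  fixes A :: "real ^ 'n ^ 'm"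
  obtains G :: "real ^ 'm ^ 'n" where "A ** G ** A = A"
proof -
  obtain g where g: "linear g" "\<forall>v\<in>range ((*v) A). A *v g v = v"
    using linear_exists_right_inverse_on [OF matrix_vector_mul_linear subspace_UNIV, of A]
    by blast
  have "A ** matrix g ** A = A"
    using g by (simp add: matrix_eq matrix_works flip: matrix_vector_mul_assoc)
  then show thesis
    by (rule that)
qed

text \<open>Near \<open>A\<close>, a matrix of the same rank has the same range as its restriction to a fixed
  complement \<open>V\<close> of the kernel of \<open>A\<close>, so only the compact unit sphere of \<open>V\<close> has to be tested.\<close>

lemma openin_cubic_nondegenerate:
  "openin (top_of_set (rank_stratum r)) {A \<in> rank_stratum r. cubic_nondegenerate A}"
proof (subst openin_subopen, intro ballI)
  fix A :: "real ^ 'm ^ 'm"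
  assume "A \<in> {A \<in> rank_stratum r. cubic_nondegenerate A}"
  then have rankA: "rank A = r" and A: "cubic_nondegenerate A"
    by (auto simp: rank_stratum_def)
  obtain G where G: "A ** G ** A = A"
    using matrix_generalized_inverse by blast
  have GA: "A *v (G *v (A *v x)) = A *v x" for x
    by (metis G matrix_vector_mul_assoc)
  define V where "V = range ((*v) (G ** A))"
  have V: "subspace V"
    unfolding V_def by (simp add: linear_subspace_image)
  have V_fix: "G *v (A *v w) = w" if "w \<in> V" for w
    using that GA by (auto simp: V_def simp flip: matrix_vector_mul_assoc)
  have "range ((*v) A) = (*v) A ` V"
  proof
    show "range ((*v) A) \<subseteq> (*v) A ` V"
    proof clarify
      fix x
      have "A *v x = A *v ((G ** A) *v x)"
        using GA by (simp flip: matrix_vector_mul_assoc)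
      then show "A *v x \<in> (*v) A ` V"
        unfolding V_def by blast
    qed
  qed auto
  then have "r = dim ((*v) A ` V)"
    using rankA by (simp add: rank_dim_range)
  also have "\<dots> = dim V"
    using V by (intro dim_image_eq matrix_vector_mul_linear inj_on_inverseI [where g = "(*v) G"])
      (simp add: V_fix span_eq_iff [THEN iffD2])
  finally have dimV: "dim V = r" ..
  define S where "S = V \<inter> sphere 0 1"
  define W where "W = {p :: (real ^ 'm ^ 'm) \<times> (real ^ 'm).
    fst p *v vec_power (fst p *v snd p) 3 \<noteq> 0}"
  have "compact S"
    unfolding S_def using V by (intro closed_Int_compact closed_subspace) auto
  moreover have "open W"
    unfolding W_def
    by (intro open_Collect_neq continuous_on_matrix_vector_mult_joint continuous_intros)
  moreover have "{A} \<times> S \<subseteq> W"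
  proof clarify
    fix w
    assume w: "w \<in> S"
    then have "A *v w \<noteq> 0"
      using V_fix [of w] by (auto simp: S_def)
    then show "(A, w) \<in> W"
      using A by (auto simp: W_def cubic_nondegenerate_def)
  qed
  \<comment> \<open>As \<open>S\<close> is compact, the tube lemma gives one neighbourhood of
    \<open>A\<close> that works for all directions in \<open>S\<close> at once.\<close>
  ultimately obtain X where X: "A \<in> X" "open X" "X \<times> S \<subseteq> W"
    using Elementary_Topology.tube_lemma [of S W A] by blast
  have "cubic_nondegenerate A'" if "A' \<in> X" "rank A' = r" for A'
  proof -
    have nz: "A' *v vec_power (A' *v w) 3 \<noteq> 0" if "w \<in> V" "w \<noteq> 0" for w
    proof -
      define u where "u = (1 / norm w) *\<^sub>R w"
      have "u \<in> S"
        using that V by (simp add: u_def S_def subspace_scale)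
      then have "A' *v vec_power (A' *v u) 3 \<noteq> 0"
        using X(3) \<open>A' \<in> X\<close> by (auto simp: W_def)
      then show ?thesis
        by (auto simp: u_def matrix_vector_mult_scaleR vec_power_scaleR)
    qed
    have zero: "vec_power 0 3 = (0 :: real ^ 'm)"
      by (simp add: vec_power_def vec_eq_iff)
    \<comment> \<open>A nonzero kernel vector in \<open>V\<close> would also be a zero of the cubic
      map. Injectivity makes the image of \<open>V\<close> have dimension r, so rank exactly r
      forces it to be the full range of \<open>A'\<close>.\<close>
    have "inj_on ((*v) A') V"
      unfolding linear_inj_on_iff_eq_0 [OF matrix_vector_mul_linear V]
      using nz zero by fastforce
    then have "dim ((*v) A' ` V) = r"
      using V dimV by (simp add: dim_image_eq span_eq_iff [THEN iffD2])
    then have "(*v) A' ` V = range ((*v) A')"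
      using V \<open>rank A' = r\<close>
      by (intro subspace_dim_equal) (auto simp: rank_dim_range linear_subspace_image)
    then show ?thesis
      unfolding cubic_nondegenerate_def
    proof (intro allI impI)
      fix x
      assume x: "A' *v vec_power (A' *v x) 3 = 0"
      have "A' *v x \<in> (*v) A' ` V"
        using \<open>(*v) A' ` V = range ((*v) A')\<close> by blast
      then obtain w where "w \<in> V" "A' *v x = A' *v w"
        by blast
      with nz [of w] x show "A' *v x = 0"
        by (cases "w = 0") auto
    qed
  qed
  then have "rank_stratum r \<inter> X \<subseteq> {A \<in> rank_stratum r. cubic_nondegenerate A}"
    by (auto simp: rank_stratum_def)
  moreover have "openin (top_of_set (rank_stratum r)) (rank_stratum r \<inter> X)"
    using X(2) by blast
  moreover have "A \<in> rank_stratum r \<inter> X"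
    using X(1) rankA by (simp add: rank_stratum_def)
  ultimately show "\<exists>T. openin (top_of_set (rank_stratum r)) T \<and> A \<in> T
      \<and> T \<subseteq> {A \<in> rank_stratum r. cubic_nondegenerate A}"
    by blast
qed

section \<open>Density by multiplication with generic invertible matrices\<close>

lemma differentiable_vec_componentwise:
  fixes f :: "'a::real_normed_vector \<Rightarrow> 'b::euclidean_space ^ 'n"
  assumes "\<And>j. (\<lambda>x. f x $ j) differentiable (at a within S)"
  shows "f differentiable (at a within S)"
proof (subst differentiable_componentwise_within, intro ballI)
  fix i :: "'b ^ 'n"
  assume "i \<in> Basis"
  then obtain j u where "i = axis j u"
    by (auto simp: Basis_vec_def)
  then show "(\<lambda>x. f x \<bullet> i) differentiable (at a within S)"
    using assms [of j] by (simp add: inner_axis differentiable_inner)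
qed

lemma transpose_mult_vec_power:
  fixes M :: "real ^ 'm ^ 'm"
  shows "transpose M *v vec_power u k = (\<Sum>j\<in>UNIV. (u $ j) ^ k *\<^sub>R M $ j)"
  by (simp add: vec_eq_iff matrix_vector_mult_def transpose_def vec_power_def mult.commute)

text \<open>If \<open>u = A x\<close> is a degenerate direction for \<open>A M\<^sup>T\<close>, normalised by \<open>u\<^sub>i = 1\<close>, then row \<open>i\<close> of \<open>M\<close> is
  \<open>k - (\<Sum>j\<noteq>i. u\<^sub>j\<^sup>3 M\<^sub>j)\<close> with \<open>k\<close> in the kernel of \<open>A\<close>. Since the range and the kernel of \<open>A\<close> have
  complementary dimensions, \<open>(u, k)\<close> is encoded by a single vector \<open>z\<close> via \<open>u = A z\<close> and
  \<open>k = z - G A z\<close>. Storing \<open>z\<close> in the unused row \<open>i\<close> exhibits the bad matrices as the image of a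
  hyperplane.\<close>

lemma negligible_degenerate_multipliers:
  fixes A :: "real ^ 'm ^ 'm"
  shows "negligible {M. \<exists>x. A *v x \<noteq> 0 \<and> A *v (transpose M *v vec_power (A *v x) 3) = 0}"
proof -
  obtain G where G: "A ** G ** A = A"
    using matrix_generalized_inverse by blast
  have GA: "A *v (G *v (A *v x)) = A *v x" for x
    by (metis G matrix_vector_mul_assoc)
  define f :: "'m \<Rightarrow> real ^ 'm ^ 'm \<Rightarrow> real ^ 'm ^ 'm" where
    "f i M = (\<chi> l. if l = i
      then (M $ i - (G ** A) *v (M $ i)) - (\<Sum>j\<in>UNIV - {i}. ((A *v (M $ i)) $ j) ^ 3 *\<^sub>R M $ j)
      else M $ l)" for i M
  define H where "H i = {M :: real ^ 'm ^ 'm. (A *v (M $ i)) $ i = 1}" for i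
  have "negligible (H i)" for i
  proof -
    \<comment> \<open>Since the right-hand side is 1, the set is negligible even if row i of
      \<open>A\<close> vanishes: it is then empty.\<close>
    have "H i = {M. axis i (A $ i) \<bullet> M = 1}"
      by (simp add: H_def matrix_vector_mul_component inner_axis' inner_axis inner_commute)
    then show ?thesis
      by (simp add: negligible_hyperplane)
  qed
  moreover have "f i differentiable_on H i" for i
  proof -
    have row: "(\<lambda>M. M $ j) differentiable (at M within S)" for j and S and M :: "real ^ 'm ^ 'm"
      by (intro linear_imp_differentiable bounded_linear.linear bounded_linear_vec_nth)
    have mv: "(\<lambda>M. B *v (M $ j)) differentiable (at M within S)"
      for j and S and B M :: "real ^ 'm ^ 'm"
      by (intro linear_imp_differentiable)
        (auto intro!: linearI simp: matrix_vector_right_distrib matrix_vector_mult_scaleR)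
    have mvc: "(\<lambda>M. (B *v (M $ j)) $ l) differentiable (at M within S)"
      for j l and S and B M :: "real ^ 'm ^ 'm"
      by (intro linear_imp_differentiable)
        (auto intro!: linearI simp: matrix_vector_right_distrib matrix_vector_mult_scaleR)
    show ?thesis
      unfolding differentiable_on_def
    proof (rule ballI, rule differentiable_vec_componentwise)
      fix M and l :: 'm
      show "(\<lambda>M. f i M $ l) differentiable (at M within H i)"
        by (cases "l = i") (simp_all add: f_def row mv mvc)
    qed
  qed
  \<comment> \<open>A differentiable map of a Euclidean space to itself sends null sets to null
    sets.\<close>
  ultimately have "negligible (f i ` H i)" for i
    by (intro negligible_differentiable_image_negligible) auto
  then have "negligible (\<Union>i\<in>UNIV. f i ` H i)"
    by (intro negligible_Union) auto
  moreover have "{M. \<exists>x. A *v x \<noteq> 0 \<and> A *v (transpose M *v vec_power (A *v x) 3) = 0}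
      \<subseteq> (\<Union>i\<in>UNIV. f i ` H i)"
  proof clarify
    fix M x
    assume "A *v x \<noteq> 0" and eq: "A *v (transpose M *v vec_power (A *v x) 3) = 0"
    then obtain i where i: "(A *v x) $ i \<noteq> 0"
      by (auto simp: vec_eq_iff)
    \<comment> \<open>The degeneracy condition is homogeneous in x, so x may be rescaled.\<close>
    define c where "c = 1 / (A *v x) $ i"
    define u where "u = A *v (c *\<^sub>R x)"
    define k where "k = transpose M *v vec_power u 3"
    have u_eq: "u = c *\<^sub>R (A *v x)"
      by (simp add: u_def matrix_vector_mult_scaleR)
    have ui: "u $ i = 1"
      using i by (simp add: u_eq c_def)
    have Ak: "A *v k = 0"
      using eq by (simp add: k_def u_eq vec_power_scaleR matrix_vector_mult_scaleR)
    have "k = M $ i + (\<Sum>j\<in>UNIV - {i}. (u $ j) ^ 3 *\<^sub>R M $ j)"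
      unfolding k_def transpose_mult_vec_power
      by (subst sum.remove [of _ i]) (auto simp: ui)
    then have Mi: "M $ i = k - (\<Sum>j\<in>UNIV - {i}. (u $ j) ^ 3 *\<^sub>R M $ j)"
      by (simp add: algebra_simps)
    define z where "z = G *v u + k"
    have Az: "A *v z = u"
      by (simp add: z_def matrix_vector_right_distrib Ak GA u_def)
    have kz: "z - (G ** A) *v z = k"
      by (simp add: Az flip: matrix_vector_mul_assoc) (simp add: z_def)
    define N where "N = (\<chi> l. if l = i then z else M $ l)"
    have "N \<in> H i"
      by (simp add: N_def H_def Az ui)
    moreover have "f i N = M"
    proof -
      have "(\<Sum>j\<in>UNIV - {i}. (u $ j) ^ 3 *\<^sub>R N $ j) = (\<Sum>j\<in>UNIV - {i}. (u $ j) ^ 3 *\<^sub>R M $ j)"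
        by (intro sum.cong) (auto simp: N_def)
      moreover have "N $ i = z" "\<And>l. l \<noteq> i \<Longrightarrow> N $ l = M $ l"
        by (simp_all add: N_def)
      ultimately have "f i N $ l = M $ l" for l
        by (simp add: f_def Az kz Mi)
      then show ?thesis
        by (simp add: vec_eq_iff)
    qed
    ultimately show "M \<in> (\<Union>i\<in>UNIV. f i ` H i)"
      by blast
  qed
  ultimately show ?thesis
    by (rule negligible_subset)
qed

lemma rank_mul_invertible_right:
  fixes A :: "real ^ 'n ^ 'm" and P :: "real ^ 'n ^ 'n"
  assumes "invertible P"
  shows "rank (A ** P) = rank A"
proof (rule antisym)
  obtain P' where "P ** P' = mat 1"
    using assms by (auto simp: invertible_def)
  then have "A = (A ** P) ** P'"
    by (simp flip: matrix_mul_assoc)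
  then show "rank A \<le> rank (A ** P)"
    by (metis rank_mul_le_left)
qed (rule rank_mul_le_left)

text \<open>The invertible M with \<open>A ** transpose M\<close> in \<open>T\<close> form an open
  set containing the identity; being nonempty and open, it cannot lie inside the null set of bad
  multipliers.\<close>

lemma cubic_nondegenerate_dense:
  fixes A :: "real ^ 'm ^ 'm"
  assumes "open T" "A \<in> T"
  obtains A' where "A' \<in> T" "rank A' = rank A" "cubic_nondegenerate A'"
proof -
  define D where "D = {M. \<exists>x. A *v x \<noteq> 0 \<and> A *v (transpose M *v vec_power (A *v x) 3) = 0}"
  define Q where "Q = {M :: real ^ 'm ^ 'm. A ** transpose M \<in> T} \<inter> {M. det M \<noteq> 0}"
  have "open {M :: real ^ 'm ^ 'm. A ** transpose M \<in> T}"
  proof -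
    have "continuous_on UNIV (\<lambda>M. A ** transpose M)"
      unfolding matrix_matrix_mult_def transpose_def
      by (simp, intro continuous_intros)
    then show ?thesis
      using \<open>open T\<close> open_vimage [of T "\<lambda>M. A ** transpose M"] by (simp add: vimage_def)
  qed
  moreover have "open {M :: real ^ 'm ^ 'm. det M \<noteq> 0}"
    unfolding det_def by (intro open_Collect_neq continuous_intros)
  ultimately have "open Q"
    unfolding Q_def by (rule open_Int)
  moreover have "mat 1 \<in> Q"
    using \<open>A \<in> T\<close> by (simp add: Q_def)
  ultimately have "\<not> negligible Q"
    using open_not_negligible by blast
  then obtain M where M: "M \<in> Q" "M \<notin> D"
    using negligible_degenerate_multipliers [of A] negligible_subset unfolding D_def by blast
  have inv: "invertible (transpose M)"
    using M(1) by (simp add: Q_def invertible_det_nz)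
  show thesis
  proof
    show "A ** transpose M \<in> T"
      using M(1) by (simp add: Q_def)
    show "rank (A ** transpose M) = rank A"
      by (rule rank_mul_invertible_right [OF inv])
    \<comment> \<open>The condition at x is the one excluded by \<open>D\<close> at the vector
      \<open>transpose M *v x\<close>.\<close>
    show "cubic_nondegenerate (A ** transpose M)"
      using M(2) unfolding cubic_nondegenerate_def D_def
      by (auto simp flip: matrix_vector_mul_assoc)
  qed
qed

theorem corollary1p6:
  fixes r :: nat
  assumes "r \<le> CARD('m::finite)"
  shows "\<exists>U :: (real ^ 'm ^ 'm) set.
           U \<subseteq> proper_matrices \<and>
           openin (top_of_set (rank_stratum r)) U \<and>
           top_of_set (rank_stratum r) closure_of U = rank_stratum r"
proof (intro exI conjI)
  let ?U = "{A :: real ^ 'm ^ 'm. A \<in> rank_stratum r \<and> cubic_nondegenerate A}"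
  show "?U \<subseteq> proper_matrices"
    by (auto simp: proper_matrices_def cubic_nondegenerate_imp_proper)
  show "openin (top_of_set (rank_stratum r)) ?U"
    by (rule openin_cubic_nondegenerate)
  show "top_of_set (rank_stratum r) closure_of ?U = rank_stratum r"
  proof
    show "rank_stratum r \<subseteq> top_of_set (rank_stratum r) closure_of ?U"
    proof
      fix A :: "real ^ 'm ^ 'm"
      assume A: "A \<in> rank_stratum r"
      have "\<exists>y. y \<in> ?U \<and> y \<in> T" if T: "A \<in> T" "openin (top_of_set (rank_stratum r)) T" for T
      proof -
        obtain T' where T': "open T'" "T = rank_stratum r \<inter> T'"
          using T(2) by (auto simp: openin_open)
        obtain A' where "A' \<in> T'" "rank A' = rank A" "cubic_nondegenerate A'"
          using cubic_nondegenerate_dense [of T' A] T' T(1) by blast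
        with A T'(2) show ?thesis
          by (auto simp: rank_stratum_def)
      qed
      with A show "A \<in> top_of_set (rank_stratum r) closure_of ?U"
        by (simp add: in_closure_of)
    qed
  qed (metis closure_of_subset_topspace topspace_euclidean_subtopology)
qed

end
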